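(* If the boundary condition is periodic or the solution has compact support, then the two-dimensional CT scheme together with the mechanical energy update given in the context conserves the total energy: $$\sum_{i,j}\left(E_{ij}^{n}+\frac12|\bm B_{ij}^{n}|^2\right)=\sum_{i,j}\left(E_{ij}^{n+1}+\frac12|\bm B_{ij}^{n+1}|^2\right).$$
   Context: Uniform 2D grid with spacings $\Delta x,\Delta y>0$, time step $\Delta t>0$. Either indices $(i,j)$ are taken periodically and the sums run over one period, or (compact support) the grid is $\mathbb Z^2$, $\bm B,\bm v$ at both time levels $n,n+1$ vanish outside a finite set of cells, and the sums run over a finite block of cells containing that set. $\bm B_{ij}=(B^x_{ij},B^y_{ij},B^z_{ij})^\top$, $\bm v_{ij}=(v^x_{ij},v^y_{ij},v^z_{ij})^\top\in\mathbb R^3$; $\rho_{ij}^{n+1}=\rho_{ij}^n>0$ (density is unchanged in this step); $E_{ij}\in\mathbb R$ is the mechanical energy (internal plus kinetic). Set $\bm B_{ij}^{n+\frac12}=\frac12(\bm B_{ij}^n+\bm B_{ij}^{n+1})$, $\bm v_{ij}^{n+\frac12}=\frac12(\bm v_{ij}^n+\bm v_{ij}^{n+1})$, $\mathbf\Omega_{ij}^{n+\frac12}=\bm B_{ij}^{n+\frac12}\times\bm v_{ij}^{n+\frac12}=(\Omega^x,\Omega^y,\Omega^z)_{ij}^{n+\frac12}$. For a grid function $f$ write $D_xf_{ij}=\frac{f_{i+1,j}-f_{i-1,j}}{2\Delta x}$, $D_yf_{ij}=\frac{f_{i,j+1}-f_{i,j-1}}{2\Delta y}$. The (implicit) CT scheme,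 holding at all $(i,j)$, is $$B^{x,n+1}_{ij}=B^{x,n}_{ij}-\Delta t\,D_y\Omega^{z,n+\frac12}_{ij},\quad B^{y,n+1}_{ij}=B^{y,n}_{ij}+\Delta t\,D_x\Omega^{z,n+\frac12}_{ij},$$ $$B^{z,n+1}_{ij}=B^{z,n}_{ij}-\Delta t\,D_x\Omega^{y,n+\frac12}_{ij}+\Delta t\,D_y\Omega^{x,n+\frac12}_{ij},$$ $$\rho_{ij}^n\bm v_{ij}^{n+1}=\rho_{ij}^n\bm v_{ij}^n-\Delta t\,\bm B_{ij}^{n+\frac12}\times\operatorname{curl}\bm B_{ij}^{n+\frac12},\qquad \operatorname{curl}\bm B_{ij}:=\left(D_yB^z_{ij},\ -D_xB^z_{ij},\ D_xB^y_{ij}-D_yB^x_{ij}\right)^\top .$$ Mechanical energy update: $E_{ij}^{n+1}=E_{ij}^n-\frac12\rho_{ij}^n|\bm v_{ij}^n|^2+\frac12\rho_{ij}^{n+1}|\bm v_{ij}^{n+1}|^2$. *)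

theory Defs
  imports "HOL-Analysis.Analysis"
begin

text \<open>Cells are indexed by pairs of integers; a periodic grid is represented by its periodic
  extension to all integer indices (see \<open>periodic_on_grid\<close> below).\<close>

type_synonym 'a grid_fun = "int \<Rightarrow> int \<Rightarrow> 'a"

text \<open>The grid functions at one time level; \<open>energy\<close> is the mechanical (internal plus kinetic)
  energy, so it does not contain the magnetic energy.\<close>

record mhd_state =
  rho :: "real grid_fun"
  mag :: "(real^3) grid_fun"
  vel :: "(real^3) grid_fun"
  energy :: "real grid_fun"

definition diff_x :: "real \<Rightarrow> real grid_fun \<Rightarrow> real grid_fun" where
  "diff_x dx f i j = (f (i + 1) j - f (i - 1) j) / (2 * dx)"

definition diff_y :: "real \<Rightarrow> real grid_fun \<Rightarrow> real grid_fun" where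
  "diff_y dy f i j = (f i (j + 1) - f i (j - 1)) / (2 * dy)"

definition field_comp :: "(real^3) grid_fun \<Rightarrow> 3 \<Rightarrow> real grid_fun" where
  "field_comp F k i j = F i j $ k"

definition curl :: "real \<Rightarrow> real \<Rightarrow> (real^3) grid_fun \<Rightarrow> (real^3) grid_fun" where
  "curl dx dy F i j = vector
     [diff_y dy (field_comp F 3) i j,
      - diff_x dx (field_comp F 3) i j,
      diff_x dx (field_comp F 2) i j - diff_y dy (field_comp F 1) i j]"

definition midpoint_level :: "(real^3) grid_fun \<Rightarrow> (real^3) grid_fun \<Rightarrow> (real^3) grid_fun" where
  "midpoint_level F G i j = (1/2) *\<^sub>R (F i j + G i j)"

text \<open>In the remaining definitions \<open>s\<close> is the state at level \<open>n\<close> and \<open>s'\<close> the one at level \<open>n + 1\<close>.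
  The scheme is implicit, hence a relation between the two.\<close>

definition mag_half :: "mhd_state \<Rightarrow> mhd_state \<Rightarrow> (real^3) grid_fun" where
  "mag_half s s' = midpoint_level (mag s) (mag s')"

definition vel_half :: "mhd_state \<Rightarrow> mhd_state \<Rightarrow> (real^3) grid_fun" where
  "vel_half s s' = midpoint_level (vel s) (vel s')"

definition Omega_half :: "mhd_state \<Rightarrow> mhd_state \<Rightarrow> (real^3) grid_fun" where
  "Omega_half s s' i j = cross3 (mag_half s s' i j) (vel_half s s' i j)"

definition CT_scheme :: "real \<Rightarrow> real \<Rightarrow> real \<Rightarrow> mhd_state \<Rightarrow> mhd_state \<Rightarrow> bool" where
  "CT_scheme dx dy dt s s' \<longleftrightarrow> (\<forall>i j.
     mag s' i j $ 1 = mag s i j $ 1 - dt * diff_y dy (field_comp (Omega_half s s') 3) i j \<and>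
     mag s' i j $ 2 = mag s i j $ 2 + dt * diff_x dx (field_comp (Omega_half s s') 3) i j \<and>
     mag s' i j $ 3 = mag s i j $ 3 - dt * diff_x dx (field_comp (Omega_half s s') 2) i j
                                    + dt * diff_y dy (field_comp (Omega_half s s') 1) i j \<and>
     rho s i j *\<^sub>R vel s' i j = rho s i j *\<^sub>R vel s i j
       - dt *\<^sub>R cross3 (mag_half s s' i j) (curl dx dy (mag_half s s') i j))"

definition mechanical_energy_update :: "mhd_state \<Rightarrow> mhd_state \<Rightarrow> bool" where
  "mechanical_energy_update s s' \<longleftrightarrow> (\<forall>i j.
     energy s' i j = energy s i j - 1/2 * rho s i j * (norm (vel s i j))\<^sup>2
                                  + 1/2 * rho s' i j * (norm (vel s' i j))\<^sup>2)"

definition periodic_on_grid :: "int \<Rightarrow> int \<Rightarrow> 'a grid_fun \<Rightarrow> bool" where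
  "periodic_on_grid Nx Ny f \<longleftrightarrow> (\<forall>i j. f (i + Nx) j = f i j \<and> f i (j + Ny) = f i j)"

definition periodic_state :: "int \<Rightarrow> int \<Rightarrow> mhd_state \<Rightarrow> bool" where
  "periodic_state Nx Ny s \<longleftrightarrow>
     periodic_on_grid Nx Ny (rho s) \<and> periodic_on_grid Nx Ny (mag s) \<and>
     periodic_on_grid Nx Ny (vel s) \<and> periodic_on_grid Nx Ny (energy s)"

text \<open>The two boundary conditions, each together with the index set \<open>I\<close> of the sums.
  In the periodic case \<open>I\<close> is one period, starting at an arbitrary cell.\<close>

definition periodic_bc :: "mhd_state \<Rightarrow> mhd_state \<Rightarrow> (int \<times> int) set \<Rightarrow> bool" where
  "periodic_bc s s' I \<longleftrightarrow> (\<exists>Nx Ny a b. Nx > 0 \<and> Ny > 0 \<and>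
     periodic_state Nx Ny s \<and> periodic_state Nx Ny s' \<and>
     I = {a..<a + Nx} \<times> {b..<b + Ny})"

text \<open>Only magnetic field and velocity have compact support; density and mechanical energy need
  not vanish anywhere.\<close>

definition compact_support_bc :: "mhd_state \<Rightarrow> mhd_state \<Rightarrow> (int \<times> int) set \<Rightarrow> bool" where
  "compact_support_bc s s' I \<longleftrightarrow> (\<exists>S a b c d. finite S \<and>
     (\<forall>i j. (i, j) \<notin> S \<longrightarrow>
        mag s i j = 0 \<and> mag s' i j = 0 \<and> vel s i j = 0 \<and> vel s' i j = 0) \<and>
     S \<subseteq> I \<and> I = {a..b} \<times> {c..d})"

definition total_energy :: "(int \<times> int) set \<Rightarrow> mhd_state \<Rightarrow> real" where
  "total_energy I s = (\<Sum>(i, j)\<in>I. energy s i j + 1/2 * (norm (mag s i j))\<^sup>2)"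

end

theory Submission
  imports Defs
begin

text \<open>Testing the induction equation with \<open>B\<close> and the momentum equation with \<open>v\<close> at the half
  level, the identity \<open>v \<bullet> (B \<times> curl B) = - curl B \<bullet> \<Omega>\<close> turns the local change of total energy into
  terms \<open>f D g + g D f\<close> with \<open>f\<close> a component of \<open>B\<close> and \<open>g\<close> one of \<open>\<Omega>\<close>. For central
  differences such a term is the backward difference of the flux \<open>f\<^sub>i g\<^sub>i\<^sub>+\<^sub>1 + g\<^sub>i f\<^sub>i\<^sub>+\<^sub>1\<close>, so its
  sum over a block telescopes to boundary fluxes, which cancel under either boundary condition.\<close>

lemma sum_backward_diff_int:
  fixes P :: "int \<Rightarrow> 'a::ab_group_add"
  assumes "a \<le> b"
  shows "(\<Sum>i\<in>{a..<b}. P i - P (i - 1)) = P (b - 1) - P (a - 1)"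
  using assms
proof (induction b rule: int_ge_induct)
  case base
  then show ?case by simp
next
  case (step b)
  then have "{a..<b + 1} = insert b {a..<b}" by auto
  with step.IH show ?case by simp
qed

text \<open>Flux through the face between cells \<open>i\<close> and \<open>i + 1\<close>.
  Exchanging the two cells leaves it unchanged, so the \<open>i - 1\<close> terms of the two central
  differences combine into the flux through the opposite face.\<close>

definition product_flux :: "(int \<Rightarrow> real) \<Rightarrow> (int \<Rightarrow> real) \<Rightarrow> int \<Rightarrow> real" where
  "product_flux f g i = f i * g (i + 1) + g i * f (i + 1)"

lemma diff_x_product:
  "f i j * diff_x dx g i j + g i j * diff_x dx f i j =
    (product_flux (\<lambda>i. f i j) (\<lambda>i. g i j) i - product_flux (\<lambda>i. f i j) (\<lambda>i. g i j) (i - 1)) / (2 * dx)"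
  by (simp add: diff_x_def product_flux_def add_divide_distrib diff_divide_distrib algebra_simps)

lemma diff_y_product:
  "f i j * diff_y dy g i j + g i j * diff_y dy f i j =
    (product_flux (f i) (g i) j - product_flux (f i) (g i) (j - 1)) / (2 * dy)"
  by (simp add: diff_y_def product_flux_def add_divide_distrib diff_divide_distrib algebra_simps)

text \<open>The sum telescopes along each row of fixed \<open>j\<close> separately. The boundary
  conditions enter through the end fluxes, which agree by periodicity or because both
  vanish.\<close>

lemma sum_diff_x_product_eq_0:
  assumes "a \<le> b"
    and "\<And>j. product_flux (\<lambda>i. f i j) (\<lambda>i. g i j) (b - 1) = product_flux (\<lambda>i. f i j) (\<lambda>i. g i j) (a - 1)"
  shows "(\<Sum>(i, j)\<in>{a..<b} \<times> J. f i j * diff_x dx g i j + g i j * diff_x dx f i j) = 0"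
proof -
  have "(\<Sum>i\<in>{a..<b}. f i j * diff_x dx g i j + g i j * diff_x dx f i j) = 0" for j
    using assms by (simp add: diff_x_product sum_backward_diff_int flip: sum_divide_distrib)
  then show ?thesis
    by (subst sum.cartesian_product[symmetric], subst sum.swap) simp
qed

lemma sum_diff_y_product_eq_0:
  assumes "c \<le> d"
    and "\<And>i. product_flux (f i) (g i) (d - 1) = product_flux (f i) (g i) (c - 1)"
  shows "(\<Sum>(i, j)\<in>J \<times> {c..<d}. f i j * diff_y dy g i j + g i j * diff_y dy f i j) = 0"
proof -
  have "(\<Sum>j\<in>{c..<d}. f i j * diff_y dy g i j + g i j * diff_y dy f i j) = 0" for i
    using assms by (simp add: diff_y_product sum_backward_diff_int flip: sum_divide_distrib)
  then show ?thesis
    by (subst sum.cartesian_product[symmetric]) simp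
qed

text \<open>The cross terms cancel by symmetry of the inner product. With the arithmetic mean of
  both levels as test vector, the increment of a quadratic energy is exact, with no remainder in the
  time step.\<close>

lemma norm_power2_diff:
  "1/2 * (norm y)\<^sup>2 - 1/2 * (norm x)\<^sup>2 = ((1/2) *\<^sub>R (x + y)) \<bullet> (y - x)"
  for x y :: "'a::real_inner"
  by (simp add: power2_norm_eq_inner inner_left_distrib inner_right_distrib inner_diff_right
      inner_commute algebra_simps)

text \<open>The momentum equation contributes products of \<open>W\<close> with differences of
  \<open>B\<close>, the induction equation the same products with the roles exchanged; together they
  form complete product-rule pairs.\<close>

lemma local_energy_balance:
  fixes dx dy dt :: real and s s' :: mhd_state
  assumes rho: "\<And>i j. rho s' i j = rho s i j"
    and CT: "CT_scheme dx dy dt s s'"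
    and mech: "mechanical_energy_update s s'"
  defines "B \<equiv> field_comp (mag_half s s')" and "W \<equiv> field_comp (Omega_half s s')"
  shows "energy s' i j + 1/2 * (norm (mag s' i j))\<^sup>2 - (energy s i j + 1/2 * (norm (mag s i j))\<^sup>2) =
    dt * ((B 2 i j * diff_x dx (W 3) i j + W 3 i j * diff_x dx (B 2) i j)
        - (B 3 i j * diff_x dx (W 2) i j + W 2 i j * diff_x dx (B 3) i j)
        + (B 3 i j * diff_y dy (W 1) i j + W 1 i j * diff_y dy (B 3) i j)
        - (B 1 i j * diff_y dy (W 3) i j + W 3 i j * diff_y dy (B 1) i j))"
proof -
  let ?b = "mag_half s s' i j" and ?v = "vel_half s s' i j" and ?c = "curl dx dy (mag_half s s') i j"
  have mag: "mag s' i j $ 1 = mag s i j $ 1 - dt * diff_y dy (W 3) i j"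
      "mag s' i j $ 2 = mag s i j $ 2 + dt * diff_x dx (W 3) i j"
      "mag s' i j $ 3 = mag s i j $ 3 - dt * diff_x dx (W 2) i j + dt * diff_y dy (W 1) i j"
    using CT unfolding CT_scheme_def W_def by blast+
  \<comment> \<open>Mechanical energy changes only by its kinetic part, and the density, equal at
    both levels, factors out.\<close>
  have "energy s' i j + 1/2 * (norm (mag s' i j))\<^sup>2 - (energy s i j + 1/2 * (norm (mag s i j))\<^sup>2) =
      rho s i j * (1/2 * (norm (vel s' i j))\<^sup>2 - 1/2 * (norm (vel s i j))\<^sup>2)
      + (1/2 * (norm (mag s' i j))\<^sup>2 - 1/2 * (norm (mag s i j))\<^sup>2)"
    using mech rho by (simp add: mechanical_energy_update_def algebra_simps)
  also have "\<dots> = ?v \<bullet> (rho s i j *\<^sub>R (vel s' i j - vel s i j)) + ?b \<bullet> (mag s' i j - mag s i j)"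
    unfolding norm_power2_diff by (simp add: vel_half_def mag_half_def midpoint_level_def)
  also have "rho s i j *\<^sub>R (vel s' i j - vel s i j) = - dt *\<^sub>R cross3 ?b ?c"
    using CT by (simp add: CT_scheme_def scaleR_diff_right)
  \<comment> \<open>Cyclic symmetry of the scalar triple product: the sign from turning
    \<open>?v\<close> x \<open>?b\<close> into \<open>?b\<close> x \<open>?v\<close> cancels the
    minus of the force term.\<close>
  also have "?v \<bullet> (- dt *\<^sub>R cross3 ?b ?c) = dt * (?c \<bullet> Omega_half s s' i j)"
    by (simp add: Omega_half_def cross3_def inner_vec_def sum_3 algebra_simps)
  also have "?c \<bullet> Omega_half s s' i j =
      W 1 i j * diff_y dy (B 3) i j - W 2 i j * diff_x dx (B 3) i j
      + W 3 i j * (diff_x dx (B 2) i j - diff_y dy (B 1) i j)"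
    by (simp add: curl_def inner_vec_def sum_3 B_def W_def field_comp_def[of "Omega_half s s'" _ i j]
        algebra_simps)
  also have "?b \<bullet> (mag s' i j - mag s i j) =
      dt * (B 2 i j * diff_x dx (W 3) i j - B 1 i j * diff_y dy (W 3) i j
        + B 3 i j * (diff_y dy (W 1) i j - diff_x dx (W 2) i j))"
    by (simp add: mag inner_vec_def sum_3 B_def W_def field_comp_def[of "mag_half s s'" _ i j]
        algebra_simps)
  finally show ?thesis
    by (simp add: algebra_simps)
qed

text \<open>Common core of both boundary conditions, which are reduced here to equal fluxes through
  opposite sides of the block.\<close>

lemma total_energy_conserved_on_block:
  fixes dx dy dt :: real and s s' :: mhd_state
  assumes "\<And>i j. rho s' i j = rho s i j"
    and "CT_scheme dx dy dt s s'"
    and "mechanical_energy_update s s'"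
    and le: "a \<le> b" "c \<le> d"
  defines "B \<equiv> field_comp (mag_half s s')" and "W \<equiv> field_comp (Omega_half s s')"
  assumes flux_x: "\<And>k l j. product_flux (\<lambda>i. B k i j) (\<lambda>i. W l i j) (b - 1)
      = product_flux (\<lambda>i. B k i j) (\<lambda>i. W l i j) (a - 1)"
    and flux_y: "\<And>k l i. product_flux (B k i) (W l i) (d - 1) = product_flux (B k i) (W l i) (c - 1)"
  shows "total_energy ({a..<b} \<times> {c..<d}) s = total_energy ({a..<b} \<times> {c..<d}) s'"
proof -
  let ?I = "{a..<b} \<times> {c..<d}"
  define X where "X k l = (\<lambda>(i, j). B k i j * diff_x dx (W l) i j + W l i j * diff_x dx (B k) i j)"
    for k l
  define Y where "Y k l = (\<lambda>(i, j). B k i j * diff_y dy (W l) i j + W l i j * diff_y dy (B k) i j)"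
    for k l
  have X: "sum (X k l) ?I = 0" for k l
    unfolding X_def using le(1) flux_x by (rule sum_diff_x_product_eq_0)
  have Y: "sum (Y k l) ?I = 0" for k l
    unfolding Y_def using le(2) flux_y by (rule sum_diff_y_product_eq_0)
  have "total_energy ?I s' - total_energy ?I s =
      (\<Sum>p\<in>?I. dt * (X 2 3 p - X 3 2 p + Y 3 1 p - Y 1 3 p))"
    unfolding total_energy_def case_prod_beta sum_subtractf[symmetric] B_def W_def X_def Y_def
    using assms(1-3) by (intro sum.cong refl local_energy_balance)
  also have "\<dots> = 0"
    by (simp add: sum.distrib sum_subtractf X Y flip: sum_distrib_left)
  finally show ?thesis by simp
qed

lemma total_energy_conserved_periodic:
  assumes "\<And>i j. rho s' i j = rho s i j"
    and "CT_scheme dx dy dt s s'"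
    and "mechanical_energy_update s s'"
    and "periodic_bc s s' I"
  shows "total_energy I s = total_energy I s'"
proof -
  obtain Nx Ny a b where N: "Nx > 0" "Ny > 0" and per: "periodic_state Nx Ny s" "periodic_state Nx Ny s'"
    and I: "I = {a..<a + Nx} \<times> {b..<b + Ny}"
    using assms(4) by (auto simp: periodic_bc_def)
  have B: "mag_half s s' (i + Nx) j = mag_half s s' i j" "mag_half s s' i (j + Ny) = mag_half s s' i j"
    and W: "Omega_half s s' (i + Nx) j = Omega_half s s' i j"
      "Omega_half s s' i (j + Ny) = Omega_half s s' i j" for i j
    using per by (simp_all add: periodic_state_def periodic_on_grid_def Omega_half_def mag_half_def
        vel_half_def midpoint_level_def)
  \<comment> \<open>The last cell of the block is the cell just before the block, shifted by one
    period; in this form \<open>B\<close> and \<open>W\<close> apply.\<close>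
  have shift: "a + Nx - 1 = (a - 1) + Nx" "b + Ny - 1 = (b - 1) + Ny" by simp_all
  show ?thesis
    unfolding I using N assms(1-3)
    by (intro total_energy_conserved_on_block)
      (simp_all add: product_flux_def field_comp_def B W shift del: add_diff_eq diff_add_eq)
qed

lemma total_energy_conserved_compact_support:
  assumes "\<And>i j. rho s' i j = rho s i j"
    and "CT_scheme dx dy dt s s'"
    and "mechanical_energy_update s s'"
    and "compact_support_bc s s' I"
  shows "total_energy I s = total_energy I s'"
proof -
  obtain S a b c d where S: "S \<subseteq> I"
    and supp: "\<And>i j. (i, j) \<notin> S \<Longrightarrow>
      mag s i j = 0 \<and> mag s' i j = 0 \<and> vel s i j = 0 \<and> vel s' i j = 0"
    and I: "I = {a..b} \<times> {c..d}"
    using assms(4) unfolding compact_support_bc_def by blast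
  \<comment> \<open>Each product in a flux through a side of the block has a factor from a cell just
    outside, so these fluxes vanish.\<close>
  have zero: "mag_half s s' i j = 0 \<and> Omega_half s s' i j = 0"
    if "i < a \<or> b < i \<or> j < c \<or> d < j" for i j
  proof -
    have "(i, j) \<notin> S" using that S I by auto
    then show ?thesis
      using supp by (simp add: Omega_half_def mag_half_def vel_half_def midpoint_level_def)
  qed
  show ?thesis
  proof (cases "a \<le> b \<and> c \<le> d")
    case True
    have "I = {a..<b + 1} \<times> {c..<d + 1}" unfolding I by auto
    then show ?thesis
      using True assms(1-3)
      by (simp only:, intro total_energy_conserved_on_block)
        (simp_all add: product_flux_def field_comp_def zero)
  next
    case False
    then have "I = {}" unfolding I by auto
    then show ?thesis by (simp add: total_energy_def)
  qed
qed

theorem theorem3p13: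
  fixes dx dy dt :: real and s s' :: mhd_state and I :: "(int \<times> int) set"
  assumes "dx > 0" and "dy > 0" and "dt > 0"
    and "\<And>i j. rho s i j > 0"
    and "\<And>i j. rho s' i j = rho s i j"
    and "CT_scheme dx dy dt s s'"
    and "mechanical_energy_update s s'"
    and "periodic_bc s s' I \<or> compact_support_bc s s' I"
  shows "total_energy I s = total_energy I s'"
  using assms(5-8) total_energy_conserved_periodic total_energy_conserved_compact_support by metis

end
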